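(* Let $\tau_0>0$, $R>0$, $x_0\in\mathbb{H}^3$. For $\mu=1,2,3$ let $f^\mu\in C^2(\mathbb{H}^3)$, $g^\mu\in C^1(\mathbb{H}^3)$ with supports contained in the geodesic ball $B_R(x_0)$. For $\tau>\tau_0$ and $x\in\mathbb{H}^3$ define $$A^\mu(\tau,x)=\partial_\tau\big(\sinh(\tau-\tau_0)M_{f^\mu}(\tau-\tau_0,x)\big)+\sinh(\tau-\tau_0)M_{g^\mu}(\tau-\tau_0,x),$$ equivalently $$A^\mu(\tau,x)=\frac{1}{4\pi\sinh^2(\tau-\tau_0)}\int_{S_{\tau-\tau_0}(x)}\Big(\sinh(\tau-\tau_0)g^\mu(y)+\cosh(\tau-\tau_0)f^\mu(y)+\sinh(\tau-\tau_0)\,\partial_{\nu}f^\mu(y)\Big)dS(y),$$ where $\partial_\nu$ is the radial derivative along the geodesic sphere. Then $A^\mu$ decays at rate $\mathcal{O}(e^{-\tau})$: there exist $C,T>0$ such that $|A^\mu(\tau,x)|\le Ce^{-\tau}$ for all $\tau\ge T$ and all $x\in\mathbb{H}^3$. (Consequently, in the time variable $t=\sinh\tau-\tau$ the decay rate is $\mathcal{O}(t^{-1})$.)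
   Context: $\mathbb{H}^3$ is hyperbolic 3-space, modeled as the upper half-space $\{(x,y,z):z>0\}$ with metric $(dx^2+dy^2+dz^2)/z^2$. This arises from the Coulomb-gauge electromagnetic wave equation $\partial_\tau^2A^\mu-\Delta_\sigma A^\mu=0$ ($\Delta_\sigma$ the Laplace–Beltrami operator of $\mathbb{H}^3$) on the hyperbolic ($K=-1$) Friedmann–Robertson–Walker space-time $ds^2=a^2(\tau)(-d\tau^2+(dx^2+dy^2+dz^2)/z^2)$, $a(\tau)=\cosh\tau-1$, $t=\sinh\tau-\tau$, with data $(f^\mu,g^\mu)$ at $\tau_0$. $S_r(x)$ is the geodesic sphere of radius $r$ centered at $x$, $dS$ its hyperbolic surface measure (total area $4\pi\sinh^2 r$), $B_R(x_0)$ the closed geodesic ball, and the geodesic spherical mean is $M_h(r,x)=\frac{1}{4\pi\sinh^2 r}\int_{S_r(x)}h(y)\,dS(y)$. *)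

theory Defs
  imports "HOL-Analysis.Analysis"
begin

text \<open>Hyperbolic 3-space: upper half-space model, points are vectors in real^3 with third
  coordinate (the height z) positive, metric (dx^2+dy^2+dz^2)/z^2.\<close>

definition H3 :: "(real^3) set" where
  "H3 = {p. p$3 > 0}"

definition hdist :: "real^3 \<Rightarrow> real^3 \<Rightarrow> real" where
  "hdist p q = arcosh (1 + (norm (p - q))^2 / (2 * p$3 * q$3))"

definition hball :: "real^3 \<Rightarrow> real \<Rightarrow> (real^3) set" where
  "hball p R = {q \<in> H3. hdist p q \<le> R}"

text \<open>The geodesic sphere of radius r>0 centred at p=(a,b,c) is the Euclidean sphere with centre
  (a,b,c cosh r) and Euclidean radius c sinh r.  We parametrise it by spherical angles
  (theta, phi) in [0,pi] x [0,2pi].\<close>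
definition sph_pt :: "real^3 \<Rightarrow> real \<Rightarrow> real \<Rightarrow> real \<Rightarrow> real^3" where
  "sph_pt p r \<theta> \<phi> = vector
     [p$1 + p$3 * sinh r * sin \<theta> * cos \<phi>,
      p$2 + p$3 * sinh r * sin \<theta> * sin \<phi>,
      p$3 * cosh r + p$3 * sinh r * cos \<theta>]"

text \<open>Hyperbolic surface area density in the (theta, phi) parametrisation: the Euclidean area
  element (c sinh r)^2 sin theta divided by the square of the height (conformal factor 1/z^2).\<close>
definition sph_density :: "real^3 \<Rightarrow> real \<Rightarrow> real \<Rightarrow> real \<Rightarrow> real" where
  "sph_density p r \<theta> \<phi> = (p$3 * sinh r)^2 * sin \<theta> / ((sph_pt p r \<theta> \<phi>)$3)^2"

definition sph_integral :: "(real^3 \<Rightarrow> real) \<Rightarrow> real \<Rightarrow> real^3 \<Rightarrow> real" where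
  "sph_integral h r p =
     integral (cbox (0,0) (pi, 2*pi))
       (\<lambda>(\<theta>,\<phi>). h (sph_pt p r \<theta> \<phi>) * sph_density p r \<theta> \<phi>)"

definition sph_mean :: "(real^3 \<Rightarrow> real) \<Rightarrow> real \<Rightarrow> real^3 \<Rightarrow> real" where
  "sph_mean h r x = sph_integral h r x / (4 * pi * (sinh r)^2)"

definition C1_on :: "'a::real_normed_vector set \<Rightarrow> ('a \<Rightarrow> 'b::real_normed_vector) \<Rightarrow> bool" where
  "C1_on S f \<longleftrightarrow> (\<exists>D :: 'a \<Rightarrow> ('a \<Rightarrow>\<^sub>L 'b).
      (\<forall>x\<in>S. (f has_derivative blinfun_apply (D x)) (at x)) \<and> continuous_on S D)"

definition C2_on :: "'a::real_normed_vector set \<Rightarrow> ('a \<Rightarrow> 'b::real_normed_vector) \<Rightarrow> bool" where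
  "C2_on S f \<longleftrightarrow> (\<exists>D :: 'a \<Rightarrow> ('a \<Rightarrow>\<^sub>L 'b).
      (\<forall>x\<in>S. (f has_derivative blinfun_apply (D x)) (at x)) \<and> C1_on S D)"

definition solA :: "(real^3 \<Rightarrow> real) \<Rightarrow> (real^3 \<Rightarrow> real) \<Rightarrow> real \<Rightarrow> real \<Rightarrow> real^3 \<Rightarrow> real" where
  "solA f g \<tau>\<^sub>0 \<tau> x =
     deriv (\<lambda>s. sinh (s - \<tau>\<^sub>0) * sph_mean f (s - \<tau>\<^sub>0) x) \<tau>
     + sinh (\<tau> - \<tau>\<^sub>0) * sph_mean g (\<tau> - \<tau>\<^sub>0) x"

end

theory Submission
  imports Defs
begin

text \<open>The substitution \<open>v = (1 / (cosh r + sinh r cos \<theta>) - cosh r) / sinh r\<close> turns the spherical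
  mean at \<open>x\<close> into the uniform average of \<open>h\<close> over the endpoints of the geodesics of length \<open>r\<close>
  from \<open>x\<close>. Since these have unit speed, differentiating under the integral bounds the
  \<open>r\<close>-derivative of \<open>sph_mean f\<close> by the mean of the hyperbolic length of the gradient of \<open>f\<close>.
  So it suffices that the integral over \<open>S\<^sub>r(x)\<close> of a bounded function supported in a fixed ball is
  bounded uniformly in \<open>r\<close> and \<open>x\<close>, which gives means of order \<open>1 / sinh\<^sup>2 r\<close>. The support lies in
  a Euclidean ball at positive height, and geodesic spheres are Euclidean spheres, so this reduces
  to the Euclidean fact that the part of a sphere inside a ball of radius \<open>L\<close> has area \<open>O(L\<^sup>2)\<close>.
  In spherical coordinates that follows by applying twice the planar fact that the part of a circle
  inside a square of side \<open>2 \<delta>\<close> has length \<open>O(\<delta>)\<close>.\<close>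

section \<open>Planar estimate: circular arcs inside a square\<close>

text \<open>The cubic Taylor error is at most \<open>x^3 / 6\<close>, and \<open>x \<le> 2\<close>
  turns this into \<open>2 * x / 3\<close>. The crude constant suffices for comparing an arc with
  its chord.\<close>

lemma sin_ge_third:
  fixes x :: real
  assumes "0 \<le> x" "x \<le> pi / 2"
  shows "x / 3 \<le> sin x"
proof -
  have "x \<le> 2" using assms pi_less_4 by simp
  then have "x * x \<le> 2 * 2" using assms by (intro mult_mono) auto
  then have "x * (x * x) \<le> x * 4" using assms by (intro mult_left_mono) auto
  moreover have "\<bar>sin x - x\<bar> \<le> x ^ 3 / 6"
    using Maclaurin_sin_bound[of x 3] assms
    by (simp add: numeral_3_eq_3 sin_coeff_def lessThan_Suc fact_numeral)
  ultimately have "\<bar>sin x - x\<bar> \<le> 4 * x / 6" by (simp add: power3_eq_cube mult.assoc)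
  then show ?thesis by linarith
qed

text \<open>Two points in one square of half-side \<delta> have a chord of length O(\<delta>). Since
  the angle between them is at most \<open>pi\<close>, the arc is comparable to the chord.\<close>

lemma circle_arc_le:
  fixes s t t' a b \<delta> :: real
  assumes "s > 0" "\<bar>t - t'\<bar> \<le> pi"
    and "\<bar>s * cos t - a\<bar> \<le> \<delta>" "\<bar>s * sin t - b\<bar> \<le> \<delta>"
    and "\<bar>s * cos t' - a\<bar> \<le> \<delta>" "\<bar>s * sin t' - b\<bar> \<le> \<delta>"
  shows "\<bar>t - t'\<bar> \<le> 12 * \<delta> / s"
proof -
  \<comment> \<open>Half the angle: the chord has length \<open>2 * s * sin d\<close>, and
    \<open>d \<le> pi / 2\<close> is the range of \<open>sin_ge_third\<close>.\<close>
  define d where "d = \<bar>t - t'\<bar> / 2"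
  have d: "0 \<le> d" "d \<le> pi / 2" using assms by (auto simp: d_def)
  have "(s * cos t - s * cos t')\<^sup>2 \<le> (2 * \<delta>)\<^sup>2" "(s * sin t - s * sin t')\<^sup>2 \<le> (2 * \<delta>)\<^sup>2"
    unfolding abs_le_square_iff[symmetric] using assms by linarith+
  moreover have "(s * cos t - s * cos t')\<^sup>2 + (s * sin t - s * sin t')\<^sup>2 = s\<^sup>2 * (4 * (sin d)\<^sup>2)"
  proof -
    have "cos (t - t') = 1 - 2 * (sin d)\<^sup>2"
      using cos_abs_real[of "t - t'"] cos_double_sin[of d] by (simp add: d_def)
    then have "4 * (sin d)\<^sup>2 = 2 - 2 * (cos t * cos t' + sin t * sin t')"
      by (simp add: cos_diff)
    moreover have "(cos t)\<^sup>2 + (sin t)\<^sup>2 = 1" "(cos t')\<^sup>2 + (sin t')\<^sup>2 = 1" by simp_all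
    ultimately show ?thesis by algebra
  qed
  \<comment> \<open>The two squares sum to at most \<open>8 * \<delta>^2\<close>, so
    \<open>(s * sin d)^2\<close> is at most \<open>2 * \<delta>^2\<close>; rounding up to
    \<open>(2 * \<delta>)^2\<close> avoids a root of two.\<close>
  ultimately have "(s * sin d)\<^sup>2 \<le> (2 * \<delta>)\<^sup>2"
    using zero_le_power2[of \<delta>] unfolding power_mult_distrib power2_eq_square[of 2] by argo
  then have "s * sin d \<le> 2 * \<delta>"
    using assms by (auto intro: power2_le_imp_le)
  moreover have "s * (d / 3) \<le> s * sin d"
    using sin_ge_third[OF d] assms by (intro mult_left_mono) auto
  ultimately have "s * d \<le> 6 * \<delta>" by simp
  then show ?thesis using assms(1) by (simp add: d_def field_simps)
qed

text \<open>By \<open>circle_arc_le\<close> the whole support lies within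
  \<open>12 * \<delta> / s\<close> of any one support point, hence in an interval twice that long.
  The domain has length \<open>pi\<close> so that any two of its angles satisfy the hypothesis of
  that lemma.\<close>

lemma integral_circle_arc_le:
  fixes F :: "real \<Rightarrow> real"
  assumes "s > 0" "0 \<le> \<delta>" and int: "F integrable_on {l..l + pi}"
    and bound: "\<And>t. t \<in> {l..l + pi} \<Longrightarrow> \<bar>F t\<bar> \<le> K"
    and supp: "\<And>t. t \<in> {l..l + pi} \<Longrightarrow> F t \<noteq> 0 \<Longrightarrow>
                 \<bar>s * cos t - a\<bar> \<le> \<delta> \<and> \<bar>s * sin t - b\<bar> \<le> \<delta>"
  shows "\<bar>integral {l..l + pi} F\<bar> \<le> 24 * K * \<delta> / s"
proof (cases "\<exists>t'\<in>{l..l + pi}. F t' \<noteq> 0")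
  case False
  then have "integral {l..l + pi} F = integral {l..l + pi} (\<lambda>_. 0)"
    by (intro integral_cong) auto
  moreover have "0 \<le> K" using bound[of l] by fastforce
  ultimately show ?thesis using assms by simp
next
  case True
  then obtain t' where t': "t' \<in> {l..l + pi}" "F t' \<noteq> 0" by blast
  define k where "k = 12 * \<delta> / s"
  have "0 \<le> k" using assms by (simp add: k_def)
  have "0 \<le> K" using bound[of l] by fastforce
  \<comment> \<open>A dominating step function. Its window may stick out of the domain, so its
    integral is computed over \<open>UNIV\<close> and only bounds the one needed.\<close>
  define G where "G = (\<lambda>t. if t \<in> {t' - k..t' + k} then K else 0)"
  have GU: "(G has_integral (K * (2 * k))) UNIV"
    using has_integral_const_real[of K "t' - k" "t' + k"] \<open>0 \<le> k\<close>
    unfolding G_def by (subst has_integral_restrict) (simp_all add: mult.commute)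
  then have Gi: "G integrable_on {l..l + pi}"
    using integrable_on_subcbox[of G UNIV l "l + pi"] by auto
  have "norm (integral {l..l + pi} F) \<le> integral {l..l + pi} G"
  proof (rule integral_norm_bound_integral[OF int Gi])
    fix t assume t: "t \<in> {l..l + pi}"
    show "norm (F t) \<le> G t"
    proof (cases "F t = 0")
      case False
      have "\<bar>t - t'\<bar> \<le> k"
        unfolding k_def
        using supp[OF t False] supp[OF t'] t t' assms
        by (intro circle_arc_le[where a=a and b=b]) auto
      then have "t \<in> {t' - k..t' + k}" by auto
      then show ?thesis using bound[OF t] by (simp add: G_def)
    qed (use \<open>0 \<le> K\<close> in \<open>simp add: G_def\<close>)
  qed
  also have "\<dots> \<le> K * (2 * k)"
    using has_integral_subset_le[OF _ integrable_integral[OF Gi] GU] \<open>0 \<le> K\<close>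
    by (auto simp: G_def)
  finally show ?thesis by (simp add: k_def field_simps)
qed

section \<open>Coordinates on geodesic spheres\<close>

lemma norm_vec3_sq: "(norm (x :: real^3))\<^sup>2 = (x$1)\<^sup>2 + (x$2)\<^sup>2 + (x$3)\<^sup>2"
  by (simp add: norm_vec_def L2_set_def sum_3)

text \<open>Reduces continuity and differentiation of triples to their scalar coordinates.\<close>

lemma vector3_axis:
  "(vector [a, b, c] :: real^3) = a *\<^sub>R axis 1 1 + b *\<^sub>R axis 2 1 + c *\<^sub>R axis 3 1"
  by (simp add: vec_eq_iff forall_3 axis_def)

lemma continuous_on_vector3 [continuous_intros]:
  fixes a b c :: "'a::topological_space \<Rightarrow> real"
  assumes "continuous_on S a" "continuous_on S b" "continuous_on S c"
  shows "continuous_on S (\<lambda>x. vector [a x, b x, c x] :: real^3)"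
  unfolding vector3_axis using assms by (intro continuous_intros)

lemma cosh_gt_abs_sinh: "\<bar>sinh r\<bar> < cosh (r::real)"
proof -
  have "(sinh r)\<^sup>2 < (cosh r)\<^sup>2" using cosh_square_eq[of r] by simp
  then show ?thesis by (simp add: power2_less_imp_less)
qed

text \<open>With \<open>w\<close> the cosine of an angle this keeps sphere points at positive height
  and the denominators of the geodesic formulas away from zero.\<close>

lemma cosh_add_sinh_pos:
  fixes r w :: real
  assumes "\<bar>w\<bar> \<le> 1"
  shows "0 < cosh r + sinh r * w"
proof -
  have "\<bar>sinh r * w\<bar> \<le> \<bar>sinh r\<bar> * 1"
    unfolding abs_mult using assms by (intro mult_left_mono) auto
  then show ?thesis using cosh_gt_abs_sinh[of r] by linarith
qed

lemma sph_pt_simps [simp]: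
  "sph_pt p r \<theta> \<phi> $ 1 = p$1 + p$3 * sinh r * sin \<theta> * cos \<phi>"
  "sph_pt p r \<theta> \<phi> $ 2 = p$2 + p$3 * sinh r * sin \<theta> * sin \<phi>"
  "sph_pt p r \<theta> \<phi> $ 3 = p$3 * (cosh r + sinh r * cos \<theta>)"
  by (simp_all add: sph_pt_def algebra_simps)

lemma sph_pt_in_H3: "p \<in> H3 \<Longrightarrow> sph_pt p r \<theta> \<phi> \<in> H3"
  by (simp add: H3_def cosh_add_sinh_pos)

lemma continuous_on_sph_integrand:
  assumes "continuous_on H3 h" "p \<in> H3"
  shows "continuous_on S (\<lambda>(\<theta>, \<phi>). h (sph_pt p r \<theta> \<phi>) * sph_density p r \<theta> \<phi>)"
proof -
  have pos: "0 < p$3 * (cosh r + sinh r * cos \<theta>)" for \<theta>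
    using assms by (simp add: H3_def cosh_add_sinh_pos)
  have "continuous_on S (\<lambda>x. sph_density p r (fst x) (snd x))"
    unfolding sph_density_def sph_pt_simps
    using pos by (intro continuous_intros) (auto simp: less_le)
  moreover have "continuous_on S (\<lambda>x. sph_pt p r (fst x) (snd x))"
    unfolding sph_pt_def by (intro continuous_intros)
  then have "continuous_on S (\<lambda>x. h (sph_pt p r (fst x) (snd x)))"
    by (rule continuous_on_compose2[OF assms(1)]) (use assms sph_pt_in_H3 in auto)
  ultimately show ?thesis
    by (auto simp: case_prod_unfold intro: continuous_on_mult)
qed

section \<open>Integrals over spheres of functions supported in a ball\<close>

text \<open>For fixed \<theta> the slice is a circle of radius \<open>\<rho> * sin \<theta>\<close>
  and the density is at most \<open>\<rho>^2 * sin \<theta> / a^2\<close> on the support; the planar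
  estimate cancels \<open>\<rho> * sin \<theta>\<close>. Applied again along the meridian it cancels
  the last \<rho>. The constant is \<open>24 * 2 * 24\<close>.\<close>

lemma sph_integral_bounded:
  fixes h :: "real^3 \<Rightarrow> real"
  assumes p: "p \<in> H3" and r: "r > 0" and h: "continuous_on H3 h"
    and bound: "\<And>y. y \<in> H3 \<Longrightarrow> \<bar>h y\<bar> \<le> H"
    and a: "a > 0" and L: "L \<ge> 0"
    and supp: "\<And>y. y \<in> H3 \<Longrightarrow> h y \<noteq> 0 \<Longrightarrow> norm (y - q) \<le> L \<and> a \<le> y$3"
  shows "\<bar>sph_integral h r p\<bar> \<le> 1152 * H * L\<^sup>2 / a\<^sup>2"
proof -
  define \<rho> where "\<rho> = p$3 * sinh r"
  have \<rho>: "\<rho> > 0" using p r by (simp add: \<rho>_def H3_def)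
  have H: "H \<ge> 0" using bound[OF p] by simp
  define G where "G = (\<lambda>(\<theta>, \<phi>). h (sph_pt p r \<theta> \<phi>) * sph_density p r \<theta> \<phi>)"
  have cont: "continuous_on S G" for S
    unfolding G_def by (rule continuous_on_sph_integrand[OF h p])
  define F where "F \<theta> = integral {0..2*pi} (\<lambda>\<phi>. G (\<theta>, \<phi>))" for \<theta>
  have inH: "sph_pt p r \<theta> \<phi> \<in> H3" for \<theta> \<phi> using p by (rule sph_pt_in_H3)
  \<comment> \<open>The first two bounds put the support of a \<phi>-slice into a horizontal square;
    the next two put the support in \<theta> into a square of the half-plane whose coordinates are
    height and distance from the vertical axis through \<open>p\<close>.\<close>
  have box: "\<bar>\<rho> * sin \<theta> * cos \<phi> - (q$1 - p$1)\<bar> \<le> L" "\<bar>\<rho> * sin \<theta> * sin \<phi> - (q$2 - p$2)\<bar> \<le> L"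
      "\<bar>\<rho> * cos \<theta> - (q$3 - p$3 * cosh r)\<bar> \<le> L"
      "\<bar>\<rho> * \<bar>sin \<theta>\<bar> - sqrt ((q$1 - p$1)\<^sup>2 + (q$2 - p$2)\<^sup>2)\<bar> \<le> L"
      "a \<le> sph_pt p r \<theta> \<phi> $ 3" if "G (\<theta>, \<phi>) \<noteq> 0" for \<theta> \<phi>
  proof -
    let ?y = "sph_pt p r \<theta> \<phi>"
    from that have "h ?y \<noteq> 0" by (auto simp: G_def)
    then have *: "norm (?y - q) \<le> L" "a \<le> ?y $ 3" using supp[OF inH] by auto
    show "a \<le> ?y $ 3" by fact
    have c: "\<bar>(?y - q) $ i\<bar> \<le> L" for i
      using component_le_norm_cart[of "?y - q" i] * by linarith
    show "\<bar>\<rho> * sin \<theta> * cos \<phi> - (q$1 - p$1)\<bar> \<le> L" "\<bar>\<rho> * sin \<theta> * sin \<phi> - (q$2 - p$2)\<bar> \<le> L"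
      "\<bar>\<rho> * cos \<theta> - (q$3 - p$3 * cosh r)\<bar> \<le> L"
      using c[of 1] c[of 2] c[of 3] by (simp_all add: \<rho>_def algebra_simps)
    \<comment> \<open>Horizontal displacements from \<open>p\<close> as complex numbers: the reverse
      triangle inequality compares their distances from the axis.\<close>
    define u where "u = Complex (\<rho> * sin \<theta> * cos \<phi>) (\<rho> * sin \<theta> * sin \<phi>)"
    define w where "w = Complex (q$1 - p$1) (q$2 - p$2)"
    have "(norm u)\<^sup>2 = (\<rho> * \<bar>sin \<theta>\<bar>)\<^sup>2 * ((cos \<phi>)\<^sup>2 + (sin \<phi>)\<^sup>2)"
      unfolding u_def cmod_power2 distrib_left by (simp add: power_mult_distrib)
    then have nu: "norm u = \<rho> * \<bar>sin \<theta>\<bar>" using \<rho> by (simp add: power2_eq_iff_nonneg)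
    have nw: "norm w = sqrt ((q$1 - p$1)\<^sup>2 + (q$2 - p$2)\<^sup>2)"
      by (simp add: w_def cmod_def)
    have "(norm (u - w))\<^sup>2 \<le> (norm (?y - q))\<^sup>2"
      unfolding norm_vec3_sq cmod_power2 by (simp add: u_def w_def \<rho>_def algebra_simps)
    then have "norm (u - w) \<le> L" using *(1) by (meson norm_ge_zero order_trans power2_le_imp_le)
    then show "\<bar>\<rho> * \<bar>sin \<theta>\<bar> - sqrt ((q$1 - p$1)\<^sup>2 + (q$2 - p$2)\<^sup>2)\<bar> \<le> L"
      using norm_triangle_ineq3[of u w] nu nw by simp
  qed
  have Fbound: "\<bar>F \<theta>\<bar> \<le> 48 * \<rho> * H * L / a\<^sup>2" if \<theta>: "\<theta> \<in> {0..pi}" for \<theta>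
  proof (cases "sin \<theta> = 0")
    case True
    then have "F \<theta> = 0" by (simp add: F_def G_def sph_density_def)
    then show ?thesis using \<rho> H L by simp
  next
    case False
    then have s: "sin \<theta> > 0" using sin_ge_zero[of \<theta>] \<theta> by auto
    have int: "(\<lambda>\<phi>. G (\<theta>, \<phi>)) integrable_on {c..d}" for c d
      by (intro integrable_continuous_interval continuous_on_compose2[OF cont[of UNIV]])
         (auto intro!: continuous_intros)
    have Gb: "\<bar>G (\<theta>, \<phi>)\<bar> \<le> H * (\<rho>\<^sup>2 * sin \<theta> / a\<^sup>2)" for \<phi>
    proof (cases "G (\<theta>, \<phi>) = 0")
      case False
      have "a\<^sup>2 \<le> (sph_pt p r \<theta> \<phi> $ 3)\<^sup>2" using box(5)[OF False] a by (intro power_mono) auto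
      then have "\<bar>sph_density p r \<theta> \<phi>\<bar> \<le> \<rho>\<^sup>2 * sin \<theta> / a\<^sup>2"
        unfolding sph_density_def \<rho>_def[symmetric]
        using s a by (auto simp del: sph_pt_simps simp: abs_mult intro!: divide_left_mono mult_pos_pos)
      then show ?thesis
        unfolding G_def prod.case abs_mult using bound[OF inH] H by (intro mult_mono) auto
    qed (use H s in simp)
    \<comment> \<open>The planar estimate covers angles up to \<open>pi\<close>, so the full circle
      is split into two halves.\<close>
    have half: "\<bar>integral {l..l + pi} (\<lambda>\<phi>. G (\<theta>, \<phi>))\<bar> \<le> 24 * \<rho> * H * L / a\<^sup>2" for l
    proof -
      have "\<bar>integral {l..l + pi} (\<lambda>\<phi>. G (\<theta>, \<phi>))\<bar>
          \<le> 24 * (H * (\<rho>\<^sup>2 * sin \<theta> / a\<^sup>2)) * L / (\<rho> * sin \<theta>)"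
        by (rule integral_circle_arc_le[where a="q$1 - p$1" and b="q$2 - p$2"])
           (use \<rho> s L int Gb box in auto)
      also have "\<dots> = 24 * \<rho> * H * L / a\<^sup>2"
        using \<rho> s a by (simp add: field_simps power2_eq_square)
      finally show ?thesis .
    qed
    have "F \<theta> = integral {0..0 + pi} (\<lambda>\<phi>. G (\<theta>, \<phi>)) + integral {pi..pi + pi} (\<lambda>\<phi>. G (\<theta>, \<phi>))"
      unfolding F_def using Henstock_Kurzweil_Integration.integral_combine[OF _ _ int[of 0 "2*pi"], of pi]
      by simp
    then show ?thesis using half[of 0] half[of pi] by simp
  qed
  have "sph_integral h r p = integral (cbox 0 pi) (\<lambda>\<theta>. integral (cbox 0 (2*pi)) (\<lambda>\<phi>. G (\<theta>, \<phi>)))"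
    unfolding sph_integral_def G_def[symmetric] by (rule integral_prod_continuous[OF cont])
  then have "sph_integral h r p = integral {0..0 + pi} F" by (simp add: F_def[abs_def])
  \<comment> \<open>The meridian is a half circle of radius \<rho>, so one application covers all
    \<theta>.\<close>
  also have "\<bar>\<dots>\<bar> \<le> 24 * (48 * \<rho> * H * L / a\<^sup>2) * L / \<rho>"
  proof (rule integral_circle_arc_le[where a="q$3 - p$3 * cosh r"
        and b="sqrt ((q$1 - p$1)\<^sup>2 + (q$2 - p$2)\<^sup>2)"])
    show "F integrable_on {0..0 + pi}"
      unfolding F_def[abs_def] using integral_integrable_2dim[OF cont, where a=0 and b=pi and c=0 and d="2*pi"] by simp
    fix \<theta> assume \<theta>: "\<theta> \<in> {0..0 + pi}"
    then show "\<bar>F \<theta>\<bar> \<le> 48 * \<rho> * H * L / a\<^sup>2" using Fbound by simp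
    assume "F \<theta> \<noteq> 0"
    then obtain \<phi> where "G (\<theta>, \<phi>) \<noteq> 0"
      unfolding F_def by fastforce
    from box[OF this] show "\<bar>\<rho> * cos \<theta> - (q$3 - p$3 * cosh r)\<bar> \<le> L \<and>
      \<bar>\<rho> * sin \<theta> - sqrt ((q$1 - p$1)\<^sup>2 + (q$2 - p$2)\<^sup>2)\<bar> \<le> L"
      using sin_ge_zero[of \<theta>] \<theta> by simp
  qed (use \<rho> L in auto)
  also have "\<dots> = 1152 * H * L\<^sup>2 / a\<^sup>2"
    using \<rho> a by (simp add: field_simps power2_eq_square)
  finally show ?thesis .
qed

section \<open>Geodesics issuing from a point\<close>

text \<open>The point at distance \<open>r\<close> from \<open>p\<close> on the geodesic whose initial direction has azimuth
  \<open>\<phi>\<close> and makes an angle with cosine \<open>v\<close> with the downward vertical.\<close>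

definition geo_pt :: "real^3 \<Rightarrow> real \<Rightarrow> real \<Rightarrow> real \<Rightarrow> real^3" where
  "geo_pt p r v \<phi> = vector
     [p$1 + p$3 * sinh r * sqrt (1 - v\<^sup>2) / (cosh r + sinh r * v) * cos \<phi>,
      p$2 + p$3 * sinh r * sqrt (1 - v\<^sup>2) / (cosh r + sinh r * v) * sin \<phi>,
      p$3 / (cosh r + sinh r * v)]"

definition geo_vel :: "real^3 \<Rightarrow> real \<Rightarrow> real \<Rightarrow> real \<Rightarrow> real^3" where
  "geo_vel p r v \<phi> = vector
     [p$3 * sqrt (1 - v\<^sup>2) / (cosh r + sinh r * v)\<^sup>2 * cos \<phi>,
      p$3 * sqrt (1 - v\<^sup>2) / (cosh r + sinh r * v)\<^sup>2 * sin \<phi>,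
      - p$3 * (sinh r + cosh r * v) / (cosh r + sinh r * v)\<^sup>2]"

lemma geo_pt_in_H3: "p \<in> H3 \<Longrightarrow> \<bar>v\<bar> \<le> 1 \<Longrightarrow> geo_pt p r v \<phi> \<in> H3"
  by (simp add: geo_pt_def H3_def cosh_add_sinh_pos)

text \<open>\<theta> is measured at the Euclidean centre of the sphere, \<open>v\<close> at its
  hyperbolic centre \<open>p\<close>. Equality of heights forces
  \<open>(cosh r + sinh r * v) * (cosh r + sinh r * cos \<theta>) = 1\<close>, which is the choice
  of \<open>v\<close>; then \<open>sqrt (1 - v^2) = sin \<theta> / D\<close> matches the horizontal
  coordinates.\<close>

lemma sph_pt_eq_geo_pt:
  assumes "r > 0" "0 \<le> \<theta>" "\<theta> \<le> pi"
  defines "v \<equiv> (1 / (cosh r + sinh r * cos \<theta>) - cosh r) / sinh r"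
  shows "\<bar>v\<bar> \<le> 1" "sph_pt p r \<theta> \<phi> = geo_pt p r v \<phi>"
proof -
  define D where "D = cosh r + sinh r * cos \<theta>"
  have D: "D > 0" unfolding D_def by (rule cosh_add_sinh_pos) simp
  have S: "sinh r > 0" using assms by simp
  have E: "cosh r + sinh r * v = 1 / D"
    using S by (simp add: v_def D_def[symmetric])
  have "v = (1 / D - cosh r) / sinh r" by (simp add: v_def D_def)
  then have "sinh r * D * v = 1 - cosh r * D"
    using D S by (simp add: field_simps)
  then have "(sinh r * D)\<^sup>2 * (1 - v\<^sup>2) = (sinh r * D)\<^sup>2 - (1 - cosh r * D)\<^sup>2"
    by algebra
  also have "\<dots> = (sinh r * sin \<theta>)\<^sup>2"
    unfolding D_def power_mult_distrib sin_squared_eq using cosh_square_eq[of r] by algebra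
  finally have "1 - v\<^sup>2 = (sinh r * sin \<theta>)\<^sup>2 / (sinh r * D)\<^sup>2"
    using D S by (simp add: eq_divide_eq mult.commute)
  also have "(sinh r * sin \<theta>)\<^sup>2 / (sinh r * D)\<^sup>2 = (sin \<theta> / D)\<^sup>2"
    using S D by (simp add: power_mult_distrib power_divide)
  finally have v: "1 - v\<^sup>2 = (sin \<theta> / D)\<^sup>2" .
  then have "v\<^sup>2 \<le> 1" by (metis diff_ge_0_iff_ge zero_le_power2)
  then show "\<bar>v\<bar> \<le> 1" by (simp add: abs_square_le_1)
  \<comment> \<open>No sign is lost in the root because \<open>sin \<theta> \<ge> 0\<close> on
    \<open>[0, pi]\<close>.\<close>
  have "sqrt (1 - v\<^sup>2) = sin \<theta> / D"
    unfolding v using D sin_ge_zero assms by simp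
  then show "sph_pt p r \<theta> \<phi> = geo_pt p r v \<phi>"
    using D S
    by (simp add: vec_eq_iff forall_3 geo_pt_def E flip: D_def)
qed

text \<open>This is unit speed in the metric scaled by the inverse height. It rests on \<open>(1 -
  v^2) + (sinh r + cosh r * v)^2 = (cosh r + sinh r * v)^2\<close>.\<close>

lemma norm_geo_vel:
  assumes "p \<in> H3" "\<bar>v\<bar> \<le> 1"
  shows "norm (geo_vel p r v \<phi>) = geo_pt p r v \<phi> $ 3"
proof -
  define E where "E = cosh r + sinh r * v"
  have E: "E > 0" unfolding E_def by (rule cosh_add_sinh_pos[OF assms(2)])
  have v: "0 \<le> 1 - v\<^sup>2" using assms by (simp add: abs_square_le_1)
  define m where "m = p$3 / E\<^sup>2"
  define s where "s = sqrt (1 - v\<^sup>2)"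
  have s: "s\<^sup>2 = 1 - v\<^sup>2" using v by (simp add: s_def)
  have vel: "geo_vel p r v \<phi> = vector [m * s * cos \<phi>, m * s * sin \<phi>, - m * (sinh r + cosh r * v)]"
    by (simp add: geo_vel_def m_def s_def E_def)
  have "(norm (geo_vel p r v \<phi>))\<^sup>2
      = m\<^sup>2 * ((1 - v\<^sup>2) * ((cos \<phi>)\<^sup>2 + (sin \<phi>)\<^sup>2) + (sinh r + cosh r * v)\<^sup>2)"
    unfolding norm_vec3_sq vel vector_3 s[symmetric] by algebra
  also have "(1 - v\<^sup>2) * ((cos \<phi>)\<^sup>2 + (sin \<phi>)\<^sup>2) + (sinh r + cosh r * v)\<^sup>2 = E\<^sup>2"
    unfolding E_def using cosh_square_eq[of r] sin_cos_squared_add2[of \<phi>] by algebra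
  also have "m\<^sup>2 * E\<^sup>2 = (p$3 / E)\<^sup>2"
    using E by (simp add: m_def field_simps power2_eq_square)
  finally have "norm (geo_vel p r v \<phi>) = p$3 / E"
    using E assms(1) by (simp add: power2_eq_iff_nonneg H3_def)
  then show ?thesis by (simp add: geo_pt_def E_def)
qed

lemma has_vector_derivative_geo_pt:
  assumes "\<bar>v\<bar> \<le> 1"
  shows "((\<lambda>r. geo_pt p r v \<phi>) has_vector_derivative geo_vel p r v \<phi>) (at r within U)"
proof -
  have E: "cosh r + sinh r * v \<noteq> 0" using cosh_add_sinh_pos[OF assms, of r] by simp
  \<comment> \<open>In the quotient rule the terms with \<open>v\<close> cancel and the numerator
    becomes \<open>cosh^2 - sinh^2 = 1\<close>.\<close>
  have *: "((\<lambda>r. sinh r / (cosh r + sinh r * v)) has_real_derivative 1 / (cosh r + sinh r * v)\<^sup>2)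
          (at r within U)"
    using E cosh_square_eq[of r]
    by (auto intro!: derivative_eq_intros simp: power2_eq_square algebra_simps)
  have 12: "((\<lambda>r. a + c * sinh r * s / (cosh r + sinh r * v) * k) has_real_derivative
        c * s / (cosh r + sinh r * v)\<^sup>2 * k) (at r within U)" for a c s k
    using DERIV_add[OF DERIV_const[of a] DERIV_cmult[OF *, of "c * s * k"]]
    by (simp add: ac_simps)
  have 3: "((\<lambda>r. c / (cosh r + sinh r * v)) has_real_derivative
        - c * (sinh r + cosh r * v) / (cosh r + sinh r * v)\<^sup>2) (at r within U)" for c
    using E by (auto intro!: derivative_eq_intros simp: power2_eq_square)
  have scale: "((\<lambda>r. u r *\<^sub>R e) has_vector_derivative u' *\<^sub>R e) (at r within U)"
    if "(u has_real_derivative u') (at r within U)" for u u' and e :: "real^3"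
    using has_vector_derivative_scaleR[OF that has_vector_derivative_const[of e]] by simp
  show ?thesis
    unfolding geo_pt_def geo_vel_def vector3_axis
    by (intro has_vector_derivative_add scale 12 3)
qed

lemma continuous_on_geo_pt:
  fixes a b c :: "'a::t2_space \<Rightarrow> real"
  assumes "continuous_on S a" "continuous_on S b" "continuous_on S c"
    and "\<And>x. x \<in> S \<Longrightarrow> \<bar>b x\<bar> \<le> 1"
  shows "continuous_on S (\<lambda>x. geo_pt p (a x) (b x) (c x))"
    and "continuous_on S (\<lambda>x. geo_vel p (a x) (b x) (c x))"
proof -
  have E: "cosh (a x) + sinh (a x) * b x \<noteq> 0" if "x \<in> S" for x
    using cosh_add_sinh_pos[OF assms(4)[OF that], of "a x"] by simp
  show "continuous_on S (\<lambda>x. geo_pt p (a x) (b x) (c x))"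
    "continuous_on S (\<lambda>x. geo_vel p (a x) (b x) (c x))"
    unfolding geo_pt_def geo_vel_def using E assms
    by (auto intro!: continuous_intros)
qed

section \<open>The spherical mean as an average over geodesics, and its radial derivative\<close>

text \<open>The substitution has \<open>dv = sin \<theta> / (cosh r + sinh r * cos \<theta>)^2
  d\<theta>\<close>, exactly the area density divided by \<open>sinh^2 r\<close>. No weight
  depending on \<open>r\<close> remains, and fixed parameters follow a geodesic as \<open>r\<close>
  varies.\<close>

lemma sph_mean_eq_geo_integral:
  assumes h: "continuous_on H3 h" and p: "p \<in> H3" and r: "r > 0"
  shows "sph_mean h r p =
    integral (cbox (-1, 0) (1, 2*pi)) (\<lambda>(v, \<phi>). h (geo_pt p r v \<phi>)) / (4 * pi)"
proof -
  define V where "V \<theta> = (1 / (cosh r + sinh r * cos \<theta>) - cosh r) / sinh r" for \<theta>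
  have S: "sinh r > 0" using r by simp
  have p3: "p$3 > 0" using p by (simp add: H3_def)
  have D: "cosh r + sinh r * cos \<theta> > 0" for \<theta> by (rule cosh_add_sinh_pos) simp
  have contG: "continuous_on (cbox (-1, 0) (1, 2*pi)) (\<lambda>(v, \<phi>). h (geo_pt p r v \<phi>))"
  proof -
    have "continuous_on (cbox (-1, 0) (1, 2*pi)) (\<lambda>x. geo_pt p r (fst x) (snd x))"
      by (intro continuous_on_geo_pt continuous_intros) auto
    then show ?thesis
      unfolding case_prod_unfold
      by (rule continuous_on_compose2[OF h]) (auto intro!: geo_pt_in_H3[OF p])
  qed
  have inner: "integral {0..pi} (\<lambda>\<theta>. h (sph_pt p r \<theta> \<phi>) * sph_density p r \<theta> \<phi>)
      = (sinh r)\<^sup>2 * integral {-1..1} (\<lambda>v. h (geo_pt p r v \<phi>))" for \<phi>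
  proof -
    have "(cosh r - sinh r) * (cosh r + sinh r) = 1"
      using cosh_square_eq[of r] by algebra
    then have "1 / (cosh r + sinh r) = cosh r - sinh r" "1 / (cosh r - sinh r) = cosh r + sinh r"
      by (auto simp: divide_eq_eq mult.commute)
    \<comment> \<open>The top of the sphere, \<open>\<theta> = 0\<close>, is reached by the upward
      vertical, where \<open>v = -1\<close>.\<close>
    then have V0: "V 0 = -1" and Vpi: "V pi = 1"
      using S by (simp_all add: V_def)
    have "((\<lambda>\<theta>. (sin \<theta> / (cosh r + sinh r * cos \<theta>)\<^sup>2) *\<^sub>R h (geo_pt p r (V \<theta>) \<phi>))
        has_integral integral {V 0..V pi} (\<lambda>v. h (geo_pt p r v \<phi>))) {0..pi}"
    proof (rule has_integral_substitution)
      show "V ` {0..pi} \<subseteq> {-1..1}"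
        using sph_pt_eq_geo_pt(1)[OF r, folded V_def] by (auto simp: abs_le_iff minus_le_iff)
      have "continuous_on {-1..1} (\<lambda>v. geo_pt p r v \<phi>)"
        by (intro continuous_on_geo_pt continuous_intros) auto
      then show "continuous_on {-1..1} (\<lambda>v. h (geo_pt p r v \<phi>))"
        by (rule continuous_on_compose2[OF h]) (auto intro!: geo_pt_in_H3[OF p])
      show "(V has_real_derivative sin \<theta> / (cosh r + sinh r * cos \<theta>)\<^sup>2) (at \<theta> within {0..pi})" for \<theta>
        unfolding V_def[abs_def] using S D[of \<theta>, THEN less_imp_neq, symmetric]
        by (auto intro!: derivative_eq_intros simp: power2_eq_square)
    qed (simp_all add: V0 Vpi)
    then have "((\<lambda>\<theta>. (sinh r)\<^sup>2 * ((sin \<theta> / (cosh r + sinh r * cos \<theta>)\<^sup>2) *\<^sub>R h (geo_pt p r (V \<theta>) \<phi>)))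
        has_integral (sinh r)\<^sup>2 * integral {-1..1} (\<lambda>v. h (geo_pt p r v \<phi>))) {0..pi}"
      unfolding V0 Vpi by (rule has_integral_mult_right)
    moreover have "(sinh r)\<^sup>2 * ((sin \<theta> / (cosh r + sinh r * cos \<theta>)\<^sup>2) *\<^sub>R h (geo_pt p r (V \<theta>) \<phi>))
        = h (sph_pt p r \<theta> \<phi>) * sph_density p r \<theta> \<phi>" if "\<theta> \<in> {0..pi}" for \<theta>
    proof -
      have "sph_density p r \<theta> \<phi> = (sinh r)\<^sup>2 * (sin \<theta> / (cosh r + sinh r * cos \<theta>)\<^sup>2)"
        using p3 by (simp add: sph_density_def power_mult_distrib)
      moreover have "sph_pt p r \<theta> \<phi> = geo_pt p r (V \<theta>) \<phi>"
        using sph_pt_eq_geo_pt(2)[OF r] that by (simp add: V_def)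
      ultimately show ?thesis by simp
    qed
    ultimately have "((\<lambda>\<theta>. h (sph_pt p r \<theta> \<phi>) * sph_density p r \<theta> \<phi>)
        has_integral (sinh r)\<^sup>2 * integral {-1..1} (\<lambda>v. h (geo_pt p r v \<phi>))) {0..pi}"
      by (rule has_integral_eq[rotated])
    then show ?thesis by (rule integral_unique)
  qed
  note cont = continuous_on_sph_integrand[OF h p]
  have "sph_integral h r p = integral (cbox 0 pi) (\<lambda>\<theta>. integral (cbox 0 (2*pi))
      (\<lambda>\<phi>. h (sph_pt p r \<theta> \<phi>) * sph_density p r \<theta> \<phi>))"
    unfolding sph_integral_def using integral_prod_continuous[OF cont] by simp
  \<comment> \<open>The substitution acts on \<theta> at fixed \<phi>, so the \<theta>-integral is
    moved inside first; the order is restored afterwards.\<close>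
  also have "\<dots> = integral (cbox 0 (2*pi)) (\<lambda>\<phi>. integral (cbox 0 pi)
      (\<lambda>\<theta>. h (sph_pt p r \<theta> \<phi>) * sph_density p r \<theta> \<phi>))"
    by (rule integral_swap_continuous[OF cont])
  also have "\<dots> = (sinh r)\<^sup>2 * integral (cbox 0 (2*pi)) (\<lambda>\<phi>. integral (cbox (-1) 1)
      (\<lambda>v. h (geo_pt p r v \<phi>)))"
    using inner by simp
  also have "integral (cbox 0 (2*pi)) (\<lambda>\<phi>. integral (cbox (-1) 1) (\<lambda>v. h (geo_pt p r v \<phi>)))
     = integral (cbox (-1) 1) (\<lambda>v. integral (cbox 0 (2*pi)) (\<lambda>\<phi>. h (geo_pt p r v \<phi>)))"
    by (rule integral_swap_continuous[OF contG, symmetric])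
  also have "\<dots> = integral (cbox (-1, 0) (1, 2*pi)) (\<lambda>(v, \<phi>). h (geo_pt p r v \<phi>))"
    using integral_prod_continuous[OF contG] by simp
  finally show ?thesis using S by (simp add: sph_mean_def)
qed

text \<open>Leibniz rule for the geodesic average: at fixed parameters the chain rule applies
  \<open>D\<close> to the velocity, and the result is jointly continuous.\<close>

lemma sph_mean_has_derivative:
  assumes D: "\<And>x. x \<in> H3 \<Longrightarrow> (f has_derivative blinfun_apply (D x)) (at x)"
    and D_cont: "continuous_on H3 D" and p: "p \<in> H3" and r: "r > 0"
  shows "((\<lambda>r. sph_mean f r p) has_real_derivative
    integral (cbox (-1, 0) (1, 2*pi))
      (\<lambda>x. blinfun_apply (D (geo_pt p r (fst x) (snd x))) (geo_vel p r (fst x) (snd x)))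
      / (4 * pi)) (at r)"
proof -
  have f: "continuous_on H3 f"
    by (meson D continuous_at_imp_continuous_on has_derivative_continuous)
  let ?B = "cbox (-1, 0) (1, 2*pi) :: (real \<times> real) set"
  have B: "\<bar>fst x\<bar> \<le> 1" if "x \<in> ?B" for x using that by (cases x) auto
  have "((\<lambda>r. integral ?B (\<lambda>x. f (geo_pt p r (fst x) (snd x)))) has_field_derivative
      integral ?B (\<lambda>x. blinfun_apply (D (geo_pt p r (fst x) (snd x))) (geo_vel p r (fst x) (snd x))))
      (at r within {0<..})"
  proof (rule leibniz_rule_field_derivative)
    fix r :: real and x :: "real \<times> real" assume x: "x \<in> ?B"
    have "((\<lambda>r. geo_pt p r (fst x) (snd x)) has_derivative (\<lambda>t. t *\<^sub>R geo_vel p r (fst x) (snd x)))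
        (at r within {0<..})"
      using has_vector_derivative_geo_pt[OF B[OF x]] by (simp add: has_vector_derivative_def)
    from has_derivative_compose[OF this D[OF geo_pt_in_H3[OF p B[OF x]]]]
    show "((\<lambda>r. f (geo_pt p r (fst x) (snd x))) has_field_derivative
        blinfun_apply (D (geo_pt p r (fst x) (snd x))) (geo_vel p r (fst x) (snd x)))
        (at r within {0<..})"
      by (simp add: has_field_derivative_def blinfun.scaleR_right mult_commute_abs)
  next
    fix r :: real
    have "continuous_on ?B (\<lambda>x. geo_pt p r (fst x) (snd x))"
      by (intro continuous_on_geo_pt continuous_intros B)
    then have "continuous_on ?B (\<lambda>x. f (geo_pt p r (fst x) (snd x)))"
      by (rule continuous_on_compose2[OF f]) (auto intro!: geo_pt_in_H3[OF p] B)
    then show "(\<lambda>x. f (geo_pt p r (fst x) (snd x))) integrable_on ?B"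
      by (rule integrable_continuous)
  next
    let ?S = "{0<..} \<times> ?B"
    have c: "continuous_on ?S (\<lambda>z. geo_pt p (fst z) (fst (snd z)) (snd (snd z)))"
      "continuous_on ?S (\<lambda>z. geo_vel p (fst z) (fst (snd z)) (snd (snd z)))"
      by (intro continuous_on_geo_pt continuous_intros B; force)+
    have "continuous_on ?S (\<lambda>z. D (geo_pt p (fst z) (fst (snd z)) (snd (snd z))))"
      by (rule continuous_on_compose2[OF D_cont c(1)]) (auto intro!: geo_pt_in_H3[OF p])
    then show "continuous_on ?S (\<lambda>(r, x). blinfun_apply (D (geo_pt p r (fst x) (snd x)))
        (geo_vel p r (fst x) (snd x)))"
      unfolding case_prod_unfold using c(2) by (intro continuous_intros)
  qed (use r in auto)
  then have "((\<lambda>r. integral ?B (\<lambda>x. f (geo_pt p r (fst x) (snd x)))) has_field_derivative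
      integral ?B (\<lambda>x. blinfun_apply (D (geo_pt p r (fst x) (snd x))) (geo_vel p r (fst x) (snd x))))
      (at r)"
    using r by (simp add: at_within_open[of r "{0<..}"])
  then have "((\<lambda>r. integral ?B (\<lambda>x. f (geo_pt p r (fst x) (snd x))) / (4 * pi)) has_real_derivative
      integral ?B (\<lambda>x. blinfun_apply (D (geo_pt p r (fst x) (snd x))) (geo_vel p r (fst x) (snd x)))
      / (4 * pi)) (at r)"
    by (rule DERIV_cdivide)
  then show ?thesis
    \<comment> \<open>The mean equals the geodesic average for \<open>r > 0\<close>, an open set,
      which is enough for the derivative at \<open>r\<close>.\<close>
    by (rule has_field_derivative_transform_within_open[of _ _ _ "{0<..}"])
       (use r sph_mean_eq_geo_integral[OF f p] in \<open>auto simp: case_prod_unfold\<close>)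
qed

text \<open>Radial geodesics have unit hyperbolic speed, so the hyperbolic length of the gradient
  at \<open>y\<close>, i.e. \<open>y$3\<close> times its Euclidean length, bounds the radial derivative.\<close>

lemma sph_mean_derivative_le:
  assumes D_cont: "continuous_on H3 D" and p: "p \<in> H3" and r: "r > 0"
  shows "\<bar>integral (cbox (-1, 0) (1, 2*pi))
      (\<lambda>x. blinfun_apply (D (geo_pt p r (fst x) (snd x))) (geo_vel p r (fst x) (snd x)))
      / (4 * pi)\<bar> \<le> sph_mean (\<lambda>y. y$3 * norm (D y :: (real^3) \<Rightarrow>\<^sub>L real)) r p"
proof -
  let ?B = "cbox (-1, 0) (1, 2*pi) :: (real \<times> real) set"
  have B: "\<bar>fst x\<bar> \<le> 1" if "x \<in> ?B" for x using that by (cases x) auto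
  let ?h = "\<lambda>y. y$3 * norm (D y)"
  have h: "continuous_on H3 ?h" using D_cont by (intro continuous_intros)
  have c: "continuous_on ?B (\<lambda>x. geo_pt p r (fst x) (snd x))"
      "continuous_on ?B (\<lambda>x. geo_vel p r (fst x) (snd x))"
    by (intro continuous_on_geo_pt continuous_intros B; assumption)+
  have sub: "(\<lambda>x. geo_pt p r (fst x) (snd x)) ` ?B \<subseteq> H3"
    by (auto intro!: geo_pt_in_H3[OF p] B)
  note Dc = continuous_on_compose2[OF D_cont c(1) sub]
  have "norm (integral ?B (\<lambda>x. blinfun_apply (D (geo_pt p r (fst x) (snd x))) (geo_vel p r (fst x) (snd x))))
     \<le> integral ?B (\<lambda>x. ?h (geo_pt p r (fst x) (snd x)))"
  proof (rule integral_norm_bound_integral)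
    show "(\<lambda>x. blinfun_apply (D (geo_pt p r (fst x) (snd x))) (geo_vel p r (fst x) (snd x)))
        integrable_on ?B"
      using Dc c by (intro integrable_continuous continuous_intros)
    show "(\<lambda>x. ?h (geo_pt p r (fst x) (snd x))) integrable_on ?B"
      using continuous_on_compose2[OF h c(1) sub] by (rule integrable_continuous)
    fix x assume "x \<in> ?B"
    then show "norm (blinfun_apply (D (geo_pt p r (fst x) (snd x))) (geo_vel p r (fst x) (snd x)))
        \<le> ?h (geo_pt p r (fst x) (snd x))"
      using norm_blinfun[of "D (geo_pt p r (fst x) (snd x))" "geo_vel p r (fst x) (snd x)"]
        norm_geo_vel[OF p B] by (simp add: mult.commute)
  qed
  then show ?thesis
    unfolding sph_mean_eq_geo_integral[OF h p r]
    by (simp add: case_prod_unfold divide_right_mono)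
qed

section \<open>Decay of the means and of the solution\<close>

text \<open>The distance bound reads \<open>|y - q|^2 \<le> k * q$3 * y$3\<close>. Comparing with
  the vertical part alone confines the ratio of the two heights to
  \<open>[1 / (k + 2), k + 2]\<close>, and the upper bound on \<open>y$3\<close> then bounds the
  Euclidean distance.\<close>

lemma hball_bounds:
  assumes "q \<in> H3"
  obtains L a where "L \<ge> 0" "a > 0" "\<And>y. y \<in> hball q R \<Longrightarrow> norm (y - q) \<le> L \<and> a \<le> y$3"
proof -
  define k where "k = 2 * (cosh R - 1)"
  have k: "k \<ge> 0" using cosh_real_ge_1[of R] by (simp add: k_def)
  have q: "q$3 > 0" using assms by (simp add: H3_def)
  show thesis
  proof (rule that[of "sqrt (k * (k + 2) * (q$3)\<^sup>2)" "q$3 / (k + 2)"])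
    fix y assume "y \<in> hball q R"
    then have y: "y$3 > 0" and d: "hdist q y \<le> R" by (auto simp: hball_def H3_def)
    define X where "X = 1 + (norm (q - y))\<^sup>2 / (2 * q$3 * y$3)"
    have X: "X \<ge> 1" using q y by (simp add: X_def)
    have "0 \<le> arcosh X" "arcosh X \<le> R"
      using d X by (simp_all add: hdist_def X_def)
    then have "cosh (arcosh X) \<le> cosh R"
      by (subst cosh_real_nonneg_le_iff) auto
    then have "X \<le> cosh R" using X by simp
    then have n: "(norm (y - q))\<^sup>2 \<le> k * (q$3 * y$3)"
      using q y by (simp add: X_def k_def field_simps norm_minus_commute)
    have "(y$3 - q$3)\<^sup>2 \<le> (norm (y - q))\<^sup>2"
      unfolding norm_vec3_sq by simp
    with n have e: "(y$3)\<^sup>2 + (q$3)\<^sup>2 \<le> (k + 2) * (q$3 * y$3)"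
      by (simp add: power2_eq_square algebra_simps)
    have "y$3 * y$3 \<le> ((k + 2) * q$3) * y$3"
      using order.trans[OF _ e, of "(y$3)\<^sup>2"] by (simp add: power2_eq_square ac_simps)
    then have y_le: "y$3 \<le> (k + 2) * q$3" using y by simp
    have "q$3 * q$3 \<le> ((k + 2) * y$3) * q$3"
      using order.trans[OF _ e, of "(q$3)\<^sup>2"] by (simp add: power2_eq_square ac_simps)
    then have "q$3 \<le> (k + 2) * y$3" using q by simp
    then have "q$3 / (k + 2) \<le> y$3" using k by (simp add: field_simps)
    moreover have "k * (q$3 * y$3) \<le> k * (q$3 * ((k + 2) * q$3))"
      using y_le k q by (intro mult_left_mono) auto
    then have "(norm (y - q))\<^sup>2 \<le> k * (k + 2) * (q$3)\<^sup>2"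
      using n by (simp add: power2_eq_square ac_simps)
    then have "norm (y - q) \<le> sqrt (k * (k + 2) * (q$3)\<^sup>2)" by (rule real_le_rsqrt)
    ultimately show "norm (y - q) \<le> sqrt (k * (k + 2) * (q$3)\<^sup>2) \<and> q$3 / (k + 2) \<le> y$3" by simp
  qed (use k q in auto)
qed

text \<open>The support lies in a Euclidean ball cut off at height \<open>a > 0\<close>, a compact
  part of \<open>H3\<close>, so \<open>h\<close> is bounded and the uniform bound on
  \<open>sph_integral\<close> applies.\<close>

lemma sph_mean_decay:
  fixes h :: "real^3 \<Rightarrow> real"
  assumes h: "continuous_on H3 h" and a: "a > 0" and L: "L \<ge> 0"
    and supp: "\<And>y. y \<in> H3 \<Longrightarrow> h y \<noteq> 0 \<Longrightarrow> norm (y - q) \<le> L \<and> a \<le> y$3"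
  obtains C where "C \<ge> 0"
    "\<And>p r. p \<in> H3 \<Longrightarrow> r > 0 \<Longrightarrow> \<bar>sph_mean h r p\<bar> \<le> C / (sinh r)\<^sup>2"
proof -
  define K where "K = cball q L \<inter> {y. a \<le> y$3}"
  have "closed {y :: real^3. a \<le> y$3}" by (intro closed_Collect_le continuous_intros)
  then have "compact K" unfolding K_def by (intro compact_Int_closed) auto
  moreover have "K \<subseteq> H3" using a by (auto simp: K_def H3_def)
  ultimately have "compact (h ` K)"
    using h by (meson compact_continuous_image continuous_on_subset)
  then obtain H0 where H0: "\<And>y. y \<in> K \<Longrightarrow> \<bar>h y\<bar> \<le> H0"
    using compact_imp_bounded bounded_iff by (metis imageI real_norm_def)
  \<comment> \<open>The maximum with 0 covers an empty \<open>K\<close>, where \<open>H0\<close>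
    could be negative.\<close>
  define H where "H = max H0 0"
  have H: "\<bar>h y\<bar> \<le> H" if "y \<in> H3" for y
  proof (cases "h y = 0")
    case False
    then have "y \<in> K" using supp[OF that] by (simp add: K_def dist_norm norm_minus_commute)
    then show ?thesis using H0 by (force simp: H_def)
  qed (simp add: H_def)
  show thesis
  proof (rule that[of "1152 * H * L\<^sup>2 / a\<^sup>2 / (4 * pi)"])
    show "0 \<le> 1152 * H * L\<^sup>2 / a\<^sup>2 / (4 * pi)" by (simp add: H_def)
    fix p :: "real^3" and r :: real assume p: "p \<in> H3" and r: "r > 0"
    have "\<bar>sph_integral h r p\<bar> \<le> 1152 * H * L\<^sup>2 / a\<^sup>2"
      by (rule sph_integral_bounded[OF p r h H a L supp])
    then have "\<bar>sph_integral h r p\<bar> / (4 * pi * (sinh r)\<^sup>2) \<le> 1152 * H * L\<^sup>2 / a\<^sup>2 / (4 * pi * (sinh r)\<^sup>2)"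
      by (intro divide_right_mono) auto
    then show "\<bar>sph_mean h r p\<bar> \<le> 1152 * H * L\<^sup>2 / a\<^sup>2 / (4 * pi) / (sinh r)\<^sup>2"
      by (simp add: sph_mean_def abs_mult)
  qed
qed

text \<open>The product rule leaves the means of \<open>f\<close> and \<open>g\<close> and the
  derivative of the former, with coefficients at most \<open>exp r\<close>. Each is
  O(\<open>1 / sinh^2 r\<close>), and \<open>exp r / sinh^2 r\<close> is O(\<open>exp (- r)\<close>)
  once \<open>r \<ge> 1\<close>.\<close>

lemma solA_decay:
  fixes f g :: "real^3 \<Rightarrow> real"
  assumes q: "q \<in> H3"
    and f: "C1_on H3 f" and g: "continuous_on H3 g"
    and f0: "\<And>y. y \<in> H3 \<Longrightarrow> y \<notin> hball q R \<Longrightarrow> f y = 0"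
    and g0: "\<And>y. y \<in> H3 \<Longrightarrow> y \<notin> hball q R \<Longrightarrow> g y = 0"
  obtains C where "C > 0"
    "\<And>\<tau> x. \<tau> \<ge> \<tau>\<^sub>0 + 1 \<Longrightarrow> x \<in> H3 \<Longrightarrow> \<bar>solA f g \<tau>\<^sub>0 \<tau> x\<bar> \<le> C * exp (- \<tau>)"
proof -
  obtain D :: "real^3 \<Rightarrow> ((real^3) \<Rightarrow>\<^sub>L real)"
    where D: "\<And>x. x \<in> H3 \<Longrightarrow> (f has_derivative blinfun_apply (D x)) (at x)"
      and D_cont: "continuous_on H3 D"
    using f by (auto simp: C1_on_def)
  obtain L a where L: "L \<ge> 0" and a: "a > 0"
    and B: "\<And>y. y \<in> hball q R \<Longrightarrow> norm (y - q) \<le> L \<and> a \<le> y$3"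
    using hball_bounds[OF q, where R=R] by blast
  define h where "h = (\<lambda>y. y$3 * norm (D y))"
  have f_cont: "continuous_on H3 f"
    by (meson D continuous_at_imp_continuous_on has_derivative_continuous)
  have h_cont: "continuous_on H3 h" unfolding h_def using D_cont by (intro continuous_intros)
  \<comment> \<open>The gradient inherits the support bounds: where they fail, \<open>f\<close>
    vanishes on a whole neighbourhood, so its derivative there is zero.\<close>
  have h_supp: "norm (y - q) \<le> L \<and> a \<le> y$3" if y: "y \<in> H3" and "h y \<noteq> 0" for y
  proof (rule ccontr)
    assume n: "\<not> (norm (y - q) \<le> L \<and> a \<le> y$3)"
    define U where "U = H3 \<inter> ({z. L < norm (z - q)} \<union> {z. z$3 < a})"
    have "open U" unfolding U_def H3_def
      by (intro open_Int open_Un open_Collect_less continuous_intros)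
    moreover have "y \<in> U" using n y by (auto simp: U_def)
    moreover have "f z = 0" if "z \<in> U" for z
      using that B f0 by (force simp: U_def)
    ultimately have "((\<lambda>_. 0) has_derivative blinfun_apply (D y)) (at y)"
      by (rule has_derivative_transform_within_open[OF D[OF y]])
    then have "blinfun_apply (D y) = (\<lambda>_. 0)"
      by (rule has_derivative_unique[OF _ has_derivative_const])
    then have "D y = 0" by (intro blinfun_eqI) simp
    then show False using that by (simp add: h_def)
  qed
  obtain Cf where Cf: "Cf \<ge> 0"
    "\<And>p r. p \<in> H3 \<Longrightarrow> r > 0 \<Longrightarrow> \<bar>sph_mean f r p\<bar> \<le> Cf / (sinh r)\<^sup>2"
    using sph_mean_decay[OF f_cont a L] B f0 by metis
  obtain Cg where Cg: "Cg \<ge> 0"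
    "\<And>p r. p \<in> H3 \<Longrightarrow> r > 0 \<Longrightarrow> \<bar>sph_mean g r p\<bar> \<le> Cg / (sinh r)\<^sup>2"
    using sph_mean_decay[OF g a L] B g0 by metis
  obtain Ch where Ch: "Ch \<ge> 0"
    "\<And>p r. p \<in> H3 \<Longrightarrow> r > 0 \<Longrightarrow> \<bar>sph_mean h r p\<bar> \<le> Ch / (sinh r)\<^sup>2"
    using sph_mean_decay[OF h_cont a L h_supp] by metis
  \<comment> \<open>16 comes from \<open>exp r / sinh^2 r \<le> 16 * exp (- r)\<close>, the
    exponential factor from \<open>r = \<tau> - \<tau>\<^sub>0\<close>; adding 1 keeps
    \<open>C\<close> positive when the other constants vanish.\<close>
  define C where "C = 16 * (Cf + Ch + Cg) * exp \<tau>\<^sub>0 + 1"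
  have "C > 0" using Cf(1) Cg(1) Ch(1) by (auto simp: C_def intro!: add_nonneg_pos)
  moreover have "\<bar>solA f g \<tau>\<^sub>0 \<tau> x\<bar> \<le> C * exp (- \<tau>)" if \<tau>: "\<tau> \<ge> \<tau>\<^sub>0 + 1" and x: "x \<in> H3" for \<tau> x
  proof -
    define r where "r = \<tau> - \<tau>\<^sub>0"
    have r: "r \<ge> 1" "r > 0" using \<tau> by (auto simp: r_def)
    define M' where "M' = integral (cbox (-1, 0) (1, 2*pi))
      (\<lambda>y. blinfun_apply (D (geo_pt x r (fst y) (snd y))) (geo_vel x r (fst y) (snd y))) / (4 * pi)"
    have M: "((\<lambda>r. sph_mean f r x) has_real_derivative M') (at r)"
      unfolding M'_def by (rule sph_mean_has_derivative[OF D D_cont x r(2)])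
    have M'_le: "\<bar>M'\<bar> \<le> Ch / (sinh r)\<^sup>2"
      using sph_mean_derivative_le[OF D_cont x r(2)] Ch(2)[OF x r(2)]
      unfolding M'_def h_def by linarith
    have "((\<lambda>r. sinh r * sph_mean f r x) has_real_derivative
        cosh r * sph_mean f r x + sinh r * M') (at r)"
      using M by (auto intro!: derivative_eq_intros)
    then have "((\<lambda>s. sinh (s - \<tau>\<^sub>0) * sph_mean f (s - \<tau>\<^sub>0) x) has_real_derivative
        cosh r * sph_mean f r x + sinh r * M') (at \<tau>)"
      using DERIV_shift[of "\<lambda>r. sinh r * sph_mean f r x" _ \<tau> "- \<tau>\<^sub>0"]
      by (simp add: r_def)
    then have A: "solA f g \<tau>\<^sub>0 \<tau> x = cosh r * sph_mean f r x + sinh r * M' + sinh r * sph_mean g r x"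
      by (simp add: solA_def DERIV_imp_deriv r_def)
    have s: "sinh r > 0" using r by simp
    have c: "cosh r \<le> exp r" "sinh r \<le> exp r"
      using s cosh_plus_sinh[of r] cosh_real_pos[of r] by linarith+
    have "\<bar>solA f g \<tau>\<^sub>0 \<tau> x\<bar> \<le> cosh r * \<bar>sph_mean f r x\<bar> + sinh r * \<bar>M'\<bar> + sinh r * \<bar>sph_mean g r x\<bar>"
      unfolding A using s
      by (intro order.trans[OF abs_triangle_ineq] add_mono) (auto simp: abs_mult)
    also have "\<dots> \<le> exp r * (Cf / (sinh r)\<^sup>2) + exp r * (Ch / (sinh r)\<^sup>2) + exp r * (Cg / (sinh r)\<^sup>2)"
      using c s Cf(2)[OF x r(2)] Cg(2)[OF x r(2)] M'_le
      by (intro add_mono mult_mono) auto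
    also have "\<dots> = (Cf + Ch + Cg) * (exp r / (sinh r)\<^sup>2)"
      by (simp add: algebra_simps add_divide_distrib)
    also have "\<dots> \<le> (Cf + Ch + Cg) * (16 * exp (- r))"
    proof -
      \<comment> \<open>These give \<open>exp (- r) \<le> exp r / 2\<close>, hence
        \<open>sinh r \<ge> exp r / 4\<close>.\<close>
      have "2 \<le> exp r" using r exp_ge_add_one_self[of r] by linarith
      moreover have "exp (- r) \<le> 1" using r by simp
      ultimately have "exp r / 4 \<le> sinh r"
        using cosh_plus_sinh[of r] cosh_minus_sinh[of r] by linarith
      then have "(exp r / 4)\<^sup>2 \<le> (sinh r)\<^sup>2" by (intro power_mono) auto
      then have "exp r / (sinh r)\<^sup>2 \<le> exp r / (exp r / 4)\<^sup>2" using s by (intro divide_left_mono) auto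
      also have "\<dots> = 16 * exp (- r)" by (simp add: exp_minus field_simps power2_eq_square)
      finally show ?thesis using Cf(1) Cg(1) Ch(1) by (intro mult_left_mono) auto
    qed
    also have "\<dots> = (C - 1) * exp (- \<tau>)" by (simp add: C_def r_def exp_diff exp_minus field_simps)
    also have "\<dots> \<le> C * exp (- \<tau>)" by (simp add: mult_right_mono)
    finally show ?thesis .
  qed
  ultimately show thesis by (rule that)
qed

lemma C1_on_imp_continuous_on: "C1_on S f \<Longrightarrow> continuous_on S f"
  by (meson C1_on_def continuous_at_imp_continuous_on has_derivative_continuous)

lemma C2_on_imp_C1_on: "C2_on S f \<Longrightarrow> C1_on S f"
  using C1_on_imp_continuous_on unfolding C2_on_def C1_on_def[of S f] by blast

theorem theorem4p1:
  fixes f g :: "nat \<Rightarrow> real^3 \<Rightarrow> real"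
    and \<tau>\<^sub>0 R :: real and x\<^sub>0 :: "real^3"
  assumes "\<tau>\<^sub>0 > 0" and "R > 0" and "x\<^sub>0 \<in> H3"
    and "\<And>\<mu>. \<mu> \<in> {1,2,3} \<Longrightarrow> C2_on H3 (f \<mu>)"
    and "\<And>\<mu>. \<mu> \<in> {1,2,3} \<Longrightarrow> C1_on H3 (g \<mu>)"
    and "\<And>\<mu> y. \<mu> \<in> {1,2,3} \<Longrightarrow> y \<in> H3 \<Longrightarrow> y \<notin> hball x\<^sub>0 R \<Longrightarrow> f \<mu> y = 0"
    and "\<And>\<mu> y. \<mu> \<in> {1,2,3} \<Longrightarrow> y \<in> H3 \<Longrightarrow> y \<notin> hball x\<^sub>0 R \<Longrightarrow> g \<mu> y = 0"
  shows "\<forall>\<mu>\<in>{1,2,3}. \<exists>C>0. \<exists>T>0. \<forall>\<tau> x. \<tau> \<ge> T \<and> \<tau> > \<tau>\<^sub>0 \<and> x \<in> H3 \<longrightarrow>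
           \<bar>solA (f \<mu>) (g \<mu>) \<tau>\<^sub>0 \<tau> x\<bar> \<le> C * exp (- \<tau>)"
proof
  fix \<mu> :: nat assume \<mu>: "\<mu> \<in> {1,2,3}"
  obtain C where "C > 0"
    "\<And>\<tau> x. \<tau> \<ge> \<tau>\<^sub>0 + 1 \<Longrightarrow> x \<in> H3 \<Longrightarrow> \<bar>solA (f \<mu>) (g \<mu>) \<tau>\<^sub>0 \<tau> x\<bar> \<le> C * exp (- \<tau>)"
    using solA_decay[OF assms(3) C2_on_imp_C1_on[OF assms(4)[OF \<mu>]]
        C1_on_imp_continuous_on[OF assms(5)[OF \<mu>]] assms(6)[OF \<mu>] assms(7)[OF \<mu>]] by blast
  \<comment> \<open>\<open>T = \<tau>\<^sub>0 + 1\<close> is positive because the initial time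
    is.\<close>
  then show "\<exists>C>0. \<exists>T>0. \<forall>\<tau> x. \<tau> \<ge> T \<and> \<tau> > \<tau>\<^sub>0 \<and> x \<in> H3 \<longrightarrow>
      \<bar>solA (f \<mu>) (g \<mu>) \<tau>\<^sub>0 \<tau> x\<bar> \<le> C * exp (- \<tau>)"
    using assms(1) by (intro exI[of _ C] conjI exI[of _ "\<tau>\<^sub>0 + 1"]) auto
qed

end
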